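(* Let $X$ be an infinite Tychonoff space and $N$ an infinite metric space such that $w(X)<2^{d(N)}$. Let $\tau$ be any topology on $C(X)$ lying between the pointwise topology $\tau_p$ and the compact-open topology $\tau_k$, i.e. $\tau_p\subseteq\tau\subseteq\tau_k$, and let $\tau'$ be any topology on $\mathrm{Lip}_0(N)$ containing the weak topology of the Banach space $\mathrm{Lip}_0(N)$. Then there is no continuous (linear or not) surjection $T\colon(C(X),\tau)\to(\mathrm{Lip}_0(N),\tau')$.
   Context: $C(X)$ is the set of all continuous real-valued functions on $X$; $\tau_p$ is the topology inherited from $\mathbb{R}^X$. $w(X)$ is the weight (minimal cardinality of a base) and $d(N)$ the density (minimal cardinality of a dense subset). For a metric space $(N,\rho)$ with a distinguished base point $e$, $\mathrm{Lip}_0(N)$ is the real Banach space of all Lipschitz functions $f\colon N\to\mathbb{R}$ with $f(e)=0$, with norm $\|f\|=\mathrm{Lip}(f)=\sup_{x\neq y}|f(x)-f(y)|/\rho(x,y)$. *)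

theory Defs
  imports "HOL-Analysis.Analysis"
begin

unbundle cardinal_syntax

section \<open>Weight and density\<close>

text \<open>Cardinals are represented, as in \<^theory>\<open>HOL.BNF_Cardinal_Order_Relation\<close>, by well-orders
  that are compared with \<open>\<le>o\<close> and \<open><o\<close>. The least cardinality of a member of a nonempty family of sets
  is determined up to \<open>=o\<close>; an arbitrary representative is chosen.\<close>

definition least_card :: "'a set set \<Rightarrow> 'a rel" where
  "least_card \<A> = (SOME r. \<exists>A\<in>\<A>. r = |A| \<and> (\<forall>B\<in>\<A>. |A| \<le>o |B| ))"

definition is_base :: "'a topology \<Rightarrow> 'a set set \<Rightarrow> bool" where
  "is_base X \<B> \<longleftrightarrow>
     (\<forall>V\<in>\<B>. openin X V) \<and>
     (\<forall>U x. openin X U \<and> x \<in> U \<longrightarrow> (\<exists>V\<in>\<B>. x \<in> V \<and> V \<subseteq> U))"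

definition is_dense :: "'a topology \<Rightarrow> 'a set \<Rightarrow> bool" where
  "is_dense X D \<longleftrightarrow> D \<subseteq> topspace X \<and> X closure_of D = topspace X"

definition topology_weight :: "'a topology \<Rightarrow> 'a set rel" where
  "topology_weight X = least_card {\<B>. is_base X \<B>}"

definition topology_density :: "'a topology \<Rightarrow> 'a rel" where
  "topology_density X = least_card {D. is_dense X D}"

lemma least_card:
  assumes "\<A> \<noteq> {}"
  shows "\<exists>A\<in>\<A>. least_card \<A> = |A| \<and> (\<forall>B\<in>\<A>. |A| \<le>o |B| )"
proof -
  have "\<exists>r\<in>card_of ` \<A>. \<forall>r'\<in>card_of ` \<A>. r \<le>o r'"
    using assms by (intro exists_minim_Card_order) (auto simp: card_of_Card_order)
  then have "\<exists>r. \<exists>A\<in>\<A>. r = |A| \<and> (\<forall>B\<in>\<A>. |A| \<le>o |B| )"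
    by auto
  then show ?thesis
    unfolding least_card_def by (rule someI_ex)
qed

lemma topology_weight:
  shows "\<exists>\<B>. is_base X \<B> \<and> topology_weight X = |\<B>| \<and> (\<forall>\<C>. is_base X \<C> \<longrightarrow> |\<B>| \<le>o |\<C>| )"
proof -
  have "is_base X {U. openin X U}"
    by (auto simp: is_base_def)
  then show ?thesis
    using least_card[of "{\<B>. is_base X \<B>}"] unfolding topology_weight_def by blast
qed

lemma topology_density:
  shows "\<exists>D. is_dense X D \<and> topology_density X = |D| \<and> (\<forall>E. is_dense X E \<longrightarrow> |D| \<le>o |E| )"
proof -
  have "is_dense X (topspace X)"
    by (simp add: is_dense_def)
  then show ?thesis
    using least_card[of "{D. is_dense X D}"] unfolding topology_density_def by blast
qed


section \<open>Spaces of continuous functions\<close>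

definition tychonoff_space :: "'a topology \<Rightarrow> bool" where
  "tychonoff_space X \<longleftrightarrow> completely_regular_space X \<and> Hausdorff_space X"

text \<open>Functions on the carrier of a space are extensional (\<open>undefined\<close> off the carrier), so that
  functions agreeing on the carrier are equal.\<close>

definition cont_fun :: "'a topology \<Rightarrow> ('a \<Rightarrow> real) set" where
  "cont_fun X = {f \<in> extensional (topspace X). continuous_map X euclideanreal f}"

definition pointwise_topology :: "'a topology \<Rightarrow> ('a \<Rightarrow> real) topology" where
  "pointwise_topology X =
     subtopology (product_topology (\<lambda>_. euclideanreal) (topspace X)) (cont_fun X)"

definition compact_open_topology :: "'a topology \<Rightarrow> ('a \<Rightarrow> real) topology" where
  "compact_open_topology X =
     topology_generated_by {{f \<in> cont_fun X. f ` K \<subseteq> U} | K U. compactin X K \<and> open U}"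

lemma topspace_pointwise_topology [simp]: "topspace (pointwise_topology X) = cont_fun X"
  by (auto simp: pointwise_topology_def cont_fun_def PiE_def)

lemma topspace_compact_open_topology [simp]: "topspace (compact_open_topology X) = cont_fun X"
proof -
  have "compactin X {}"
    by simp
  then have "cont_fun X \<in> {{f \<in> cont_fun X. f ` K \<subseteq> U} | K U. compactin X K \<and> open U}"
    by (intro CollectI exI[of _ "{}"] exI[of _ UNIV]) auto
  then show ?thesis
    unfolding compact_open_topology_def topology_generated_by_topspace by blast
qed


section \<open>The Banach space of Lipschitz functions vanishing at a base point\<close>

definition Lip0 :: "'b metric \<Rightarrow> 'b \<Rightarrow> ('b \<Rightarrow> real) set" where
  "Lip0 N e = {f \<in> extensional (mspace N). Lipschitz_continuous_map N euclidean_metric f \<and> f e = 0}"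

text \<open>The following supremum is over a nonempty set as soon as \<open>N\<close> has two points.\<close>

definition Lip_norm :: "'b metric \<Rightarrow> ('b \<Rightarrow> real) \<Rightarrow> real" where
  "Lip_norm N f =
     (SUP (x, y) \<in> {(x, y). x \<in> mspace N \<and> y \<in> mspace N \<and> x \<noteq> y}. \<bar>f x - f y\<bar> / mdist N x y)"

text \<open>The continuous (i.e. norm-bounded) linear functionals on \<open>Lip0 N e\<close>, for the pointwise vector
  space operations. Their values off \<open>Lip0 N e\<close> are irrelevant.\<close>

definition Lip0_dual :: "'b metric \<Rightarrow> 'b \<Rightarrow> (('b \<Rightarrow> real) \<Rightarrow> real) set" where
  "Lip0_dual N e =
     {\<phi>. (\<forall>f\<in>Lip0 N e. \<forall>g\<in>Lip0 N e. \<phi> (\<lambda>x\<in>mspace N. f x + g x) = \<phi> f + \<phi> g) \<and>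
         (\<forall>f\<in>Lip0 N e. \<forall>c. \<phi> (\<lambda>x\<in>mspace N. c * f x) = c * \<phi> f) \<and>
         (\<exists>C. \<forall>f\<in>Lip0 N e. \<bar>\<phi> f\<bar> \<le> C * Lip_norm N f)}"

definition Lip0_weak_topology :: "'b metric \<Rightarrow> 'b \<Rightarrow> ('b \<Rightarrow> real) topology" where
  "Lip0_weak_topology N e =
     topology_generated_by {{f \<in> Lip0 N e. \<phi> f \<in> U} | \<phi> U. \<phi> \<in> Lip0_dual N e \<and> open U}"

lemma Lip_norm_bound:
  assumes "f \<in> Lip0 N e" "x \<in> mspace N" "y \<in> mspace N"
  shows "\<bar>f x - f y\<bar> \<le> Lip_norm N f * mdist N x y"
proof (cases "x = y")
  case False
  then have pos: "0 < mdist N x y"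
    using assms by (metis mdist_nonneg mdist_zero order_le_less)
  obtain B where B: "\<And>u v. u \<in> mspace N \<Longrightarrow> v \<in> mspace N \<Longrightarrow> \<bar>f u - f v\<bar> \<le> B * mdist N u v"
    using assms(1) by (auto simp: Lip0_def Lipschitz_continuous_map_def dist_real_def)
  have pos': "0 < mdist N u v" if "u \<in> mspace N" "v \<in> mspace N" "u \<noteq> v" for u v
    using that by (metis mdist_nonneg mdist_zero order_le_less)
  have "\<bar>f x - f y\<bar> / mdist N x y \<le> Lip_norm N f"
    unfolding Lip_norm_def
  proof (rule cSUP_upper2[where x = "(x, y)"])
    show "bdd_above ((\<lambda>(x, y). \<bar>f x - f y\<bar> / mdist N x y) `
        {(x, y). x \<in> mspace N \<and> y \<in> mspace N \<and> x \<noteq> y})"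
      by (rule bdd_aboveI[where M = B]) (auto simp: pos_divide_le_eq pos' B)
  qed (use assms False in auto)
  then show ?thesis
    using pos by (simp add: divide_le_eq)
next
  case True
  then have "mdist N x y = 0"
    using assms by (metis mdist_zero)
  then show ?thesis
    using True by simp
qed

lemma topspace_Lip0_weak_topology [simp]: "topspace (Lip0_weak_topology N e) = Lip0 N e"
proof -
  have "(\<lambda>_. 0) \<in> Lip0_dual N e"
    by (auto simp: Lip0_dual_def intro!: exI[of _ 0])
  then have "Lip0 N e \<in> {{f \<in> Lip0 N e. \<phi> f \<in> U} | \<phi> U. \<phi> \<in> Lip0_dual N e \<and> open U}"
    by (intro CollectI exI[of _ "\<lambda>_. 0"] exI[of _ UNIV]) auto
  then show ?thesis
    unfolding Lip0_weak_topology_def topology_generated_by_topspace by blast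
qed


section \<open>Comparison of topologies\<close>

definition coarser_topology :: "'a topology \<Rightarrow> 'a topology \<Rightarrow> bool" where
  "coarser_topology S T \<longleftrightarrow> topspace S = topspace T \<and> (\<forall>U. openin S U \<longrightarrow> openin T U)"

end

theory Submission
  imports Defs "HOL-Library.Countable_Set_Type"
begin

text \<open>
  A continuous surjection carries dense sets to dense sets, so it suffices to compare densities.
  Making the topology of the domain finer and that of the range coarser preserves continuity; hence
  only the compact-open topology on \<open>C(X)\<close> and the weak topology on \<open>Lip\<^sub>0(N)\<close> matter.

  The domain has a dense set of size at most \<open>w(X)\<close> (\<open>compact_open_dense_subset\<close>): for a base
  \<open>\<B>\<close> of \<open>X\<close> and a countable base \<open>\<Q>\<close> of the real line, the sets of all \<open>f\<close> satisfying finitely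
  many conditions \<open>f(B) \<subseteq> Q\<close> form a network.

  Every weakly dense \<open>D \<subseteq> Lip\<^sub>0(N)\<close> has at least \<open>2\<^bsup>d(N)\<^esup>\<close> elements. This rests on two facts.

  First, a metric space has as many pairwise disjoint nonempty open sets as its density, even
  when the density is a singular cardinal (\<open>cellular_ge_density\<close>). For this, one works in a
  maximal disjoint family of open sets \<open>U\<close>, each of which has the least density among all its
  nonempty open subsets. Unless it is a point, such a \<open>U\<close> contains infinitely many disjoint open
  sets of the same density as \<open>U\<close>. If no separated subset of \<open>U\<close> has full size, then copies of the
  maximal \<open>1/n\<close>-separated subsets of \<open>U\<close>, \<open>n = 1, 2, ...\<close>, find room in different ones of
  these open sets, and together these subsets are dense in \<open>U\<close>.
  Placing tent functions on a suitable subfamily \<open>\<J>\<close> of equal size gives norm-one functionals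
  \<open>\<delta>\<^sub>C f = (f(p\<^sub>C) - f(q\<^sub>C)) / \<rho>(p\<^sub>C, q\<^sub>C)\<close> and, for each \<open>\<A> \<subseteq> \<J>\<close>, a function \<open>f\<^sub>\<A>\<close> in
  \<open>Lip\<^sub>0(N)\<close> with \<open>\<delta>\<^sub>C f\<^sub>\<A> = 1/2\<close> for \<open>C \<in> \<A>\<close> and \<open>0\<close> for \<open>C \<in> \<J> - \<A>\<close>
  (\<open>Lip0_separating_pairs\<close>).

  Secondly, finitely many elements of \<open>D\<close> determine \<open>\<A>\<close> (\<open>card_of_Pow_le_weakly_dense\<close>). In the
  unit ball of the dual, the functionals \<open>\<phi>\<close> with \<open>\<phi> f\<^sub>\<A> = 1/2\<close> and the \<open>\<psi>\<close> with \<open>\<psi> f\<^sub>\<A> = 0\<close> form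
  two compact sets for pointwise convergence. As \<open>D\<close> is weakly dense, each such pair is separated
  by the value \<open>1/4\<close> at some \<open>g \<in> D\<close>, and by compactness finitely many \<open>g\<close> serve all pairs. They
  serve the \<open>\<delta>\<^sub>C\<close> in particular, so \<open>\<A>\<close> is a union of classes of the finite partition of \<open>\<J>\<close>
  according to which of these \<open>g\<close> satisfy \<open>\<delta>\<^sub>C g > 1/4\<close>. Hence \<open>2\<^bsup>|\<J>|\<^esup> \<le> |D|\<close>.
\<close>


section \<open>Finite subsets and maximal families\<close>

lemma card_of_Fpow_le:
  assumes "infinite A"
  shows "|Fpow A| \<le>o |A|"
proof -
  define P where "P n = {X. X \<subseteq> A \<and> finite X \<and> card X = n}" for n
  have P: "|P n| \<le>o |A|" for n
  proof (induction n)
    case 0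
    have "P 0 \<subseteq> {{}}" by (auto simp: P_def)
    then have "finite (P 0)" by (rule finite_subset) simp
    then show ?case using assms by (simp add: ordLeq3_finite_infinite)
  next
    case (Suc n)
    have "P (Suc n) \<subseteq> (\<lambda>(a, X). insert a X) ` (A \<times> P n)"
    proof
      fix X assume X: "X \<in> P (Suc n)"
      then obtain a where a: "a \<in> X" by (fastforce simp: P_def)
      then have "X - {a} \<in> P n" "a \<in> A" "X = insert a (X - {a})"
        using X by (auto simp: P_def card_Diff_singleton)
      then show "X \<in> (\<lambda>(a, X). insert a X) ` (A \<times> P n)"
        by (intro image_eqI[where x = "(a, X - {a})"]) auto
    qed
    then have "|P (Suc n)| \<le>o |A \<times> P n|"
      by (meson card_of_image card_of_mono1 ordLeq_transitive)
    also have "|A \<times> P n| \<le>o |A|"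
      using assms Suc by (intro card_of_Sigma_ordLeq_infinite) (auto simp: ordLeq_refl[OF card_of_Card_order])
    finally show ?case .
  qed
  have "Fpow A = (\<Union>n. P n)" by (auto simp: Fpow_def P_def)
  moreover have "|\<Union>n. P n| \<le>o |A|"
    using assms P by (intro card_of_UNION_ordLeq_infinite) (auto simp: infinite_iff_card_of_nat)
  ultimately show ?thesis by simp
qed

text \<open>Zorn's lemma in the form used for separated sets, for disjoint families and for the thinning
  of a disjoint family. Both orders of the arguments occur in the conclusion because \<open>R\<close> need not be
  symmetric.\<close>

lemma maximal_pairwise_subset:
  obtains M where "M \<subseteq> S" "pairwise R M"
    and "\<And>x. x \<in> S \<Longrightarrow> x \<notin> M \<Longrightarrow> \<exists>y\<in>M. \<not> (R x y \<and> R y x)"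
proof -
  let ?\<A> = "{M. M \<subseteq> S \<and> pairwise R M}"
  have "\<exists>M\<in>?\<A>. \<forall>X\<in>?\<A>. M \<subseteq> X \<longrightarrow> X = M"
  proof (rule subset_Zorn')
    fix \<C> assume C: "subset.chain ?\<A> \<C>"
    then have "pairwise R (\<Union>\<C>)"
      by (intro pairwise_chain_Union) (force simp: subset.chain_def chains_def chain_subset_def)+
    then show "\<Union>\<C> \<in> ?\<A>" using C by (auto simp: pred_on.chain_def)
  qed
  then obtain M where M: "M \<subseteq> S" "pairwise R M"
      and max: "\<And>X. X \<subseteq> S \<Longrightarrow> pairwise R X \<Longrightarrow> M \<subseteq> X \<Longrightarrow> X = M"
    by auto
  have "\<exists>y\<in>M. \<not> (R x y \<and> R y x)" if "x \<in> S" "x \<notin> M" for x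
  proof (rule ccontr)
    assume "\<not> ?thesis"
    then have "pairwise R (insert x M)" using M by (auto simp: pairwise_insert)
    then show False using max[of "insert x M"] M that by auto
  qed
  with M that show thesis by blast
qed


section \<open>A small dense set of continuous functions\<close>

lemma infinite_base_of_infinite_Hausdorff_space:
  assumes "Hausdorff_space X" "infinite (topspace X)" "is_base X \<B>"
  shows "infinite \<B>"
proof
  assume "finite \<B>"
  have "inj_on (\<lambda>x. {B \<in> \<B>. x \<in> B}) (topspace X)"
  proof (rule inj_onI, rule ccontr)
    fix x y assume xy: "x \<in> topspace X" "y \<in> topspace X" "x \<noteq> y"
      and eq: "{B \<in> \<B>. x \<in> B} = {B \<in> \<B>. y \<in> B}"
    then obtain U V where UV: "openin X U" "x \<in> U" "y \<in> V" "disjnt U V"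
      using assms(1) unfolding Hausdorff_space_def by metis
    then obtain B where "B \<in> \<B>" "x \<in> B" "B \<subseteq> U"
      using assms(3) unfolding is_base_def by metis
    with eq UV show False by (auto simp: disjnt_iff)
  qed
  moreover have "(\<lambda>x. {B \<in> \<B>. x \<in> B}) ` topspace X \<subseteq> Pow \<B>" by auto
  ultimately show False
    using \<open>finite \<B>\<close> assms(2) by (meson finite_Pow_iff finite_imageD finite_subset)
qed

text \<open>The sets of functions satisfying finitely many conditions \<open>f(B) \<subseteq> Q\<close> form a network. They are
  closed under intersection, so only a subbasic set \<open>f(K) \<subseteq> U\<close> needs an argument: the compact set
  \<open>K\<close> is covered by finitely many \<open>B \<in> \<B>\<close> with \<open>f(B) \<subseteq> Q \<subseteq> U\<close>. The sets of the network
  need not be open, since the \<open>B\<close> are not compact.\<close>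

lemma compact_open_network:
  assumes base: "is_base X \<B>"
    and Q: "topological_basis (\<Q> :: real set set)"
    and W: "openin (compact_open_topology X) W" and f: "f \<in> W"
  shows "\<exists>\<Phi>\<in>Fpow (\<B> \<times> \<Q>). (\<forall>(B, Q)\<in>\<Phi>. f ` B \<subseteq> Q) \<and>
           {g \<in> cont_fun X. \<forall>(B, Q)\<in>\<Phi>. g ` B \<subseteq> Q} \<subseteq> W"
proof -
  let ?P = "\<lambda>\<Phi>. {g \<in> cont_fun X. \<forall>(B, Q)\<in>\<Phi>. g ` B \<subseteq> Q}"
  have "f \<in> cont_fun X"
    using openin_subset[OF W] f by auto
  have "generate_topology_on {{f \<in> cont_fun X. f ` K \<subseteq> U} | K U. compactin X K \<and> open U} W"
    using W unfolding compact_open_topology_def by (rule openin_topology_generated_by)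
  then have "\<exists>\<Phi>\<in>Fpow (\<B> \<times> \<Q>). f \<in> ?P \<Phi> \<and> ?P \<Phi> \<subseteq> W"
    using f
  proof induction
    case Empty
    then show ?case by simp
  next
    case (Int a b)
    then obtain \<Phi> \<Psi> where "\<Phi> \<in> Fpow (\<B> \<times> \<Q>)" "f \<in> ?P \<Phi>" "?P \<Phi> \<subseteq> a"
      "\<Psi> \<in> Fpow (\<B> \<times> \<Q>)" "f \<in> ?P \<Psi>" "?P \<Psi> \<subseteq> b" by blast
    moreover have "?P (\<Phi> \<union> \<Psi>) = ?P \<Phi> \<inter> ?P \<Psi>" by (simp add: ball_Un) blast
    ultimately show ?case
      by (intro bexI[of _ "\<Phi> \<union> \<Psi>"]) (auto simp: Fpow_def)
  next
    case (UN K)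
    then show ?case by (meson Union_iff Union_upper subset_trans)
  next
    case (Basis s)
    then obtain K U where KU: "s = {f \<in> cont_fun X. f ` K \<subseteq> U}" "compactin X K" "open U"
      by auto
    have "\<exists>B Q. B \<in> \<B> \<and> Q \<in> \<Q> \<and> x \<in> B \<and> f ` B \<subseteq> Q \<and> Q \<subseteq> U" if x: "x \<in> K" for x
    proof -
      have "f x \<in> U" using x Basis KU by auto
      then obtain Q where Q': "Q \<in> \<Q>" "f x \<in> Q" "Q \<subseteq> U"
        using Q KU(3) by (metis topological_basisE)
      have "openin X {y \<in> topspace X. f y \<in> Q}"
        using \<open>f \<in> cont_fun X\<close> Q' topological_basis_open[OF Q]
        by (intro openin_continuous_map_preimage) (auto simp: cont_fun_def)
      moreover have "x \<in> {y \<in> topspace X. f y \<in> Q}"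
        using x KU(2) Q' compactin_subset_topspace by fastforce
      ultimately obtain B where "B \<in> \<B>" "x \<in> B" "B \<subseteq> {y \<in> topspace X. f y \<in> Q}"
        using base unfolding is_base_def by meson
      with Q' show ?thesis by blast
    qed
    then obtain B Q where BQ: "\<And>x. x \<in> K \<Longrightarrow> B x \<in> \<B> \<and> Q x \<in> \<Q> \<and> x \<in> B x \<and> f ` B x \<subseteq> Q x \<and> Q x \<subseteq> U"
      by metis
    have "\<exists>\<F>. finite \<F> \<and> \<F> \<subseteq> B ` K \<and> K \<subseteq> \<Union>\<F>"
    proof -
      have "(\<forall>V\<in>B ` K. openin X V)" using base BQ unfolding is_base_def by blast
      moreover have "K \<subseteq> \<Union>(B ` K)" using BQ by blast
      ultimately show ?thesis using KU(2) unfolding compactin_def by meson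
    qed
    then obtain K' where K': "finite K'" "K' \<subseteq> K" "K \<subseteq> (\<Union>x\<in>K'. B x)"
      by (metis finite_subset_image)
    show ?case
    proof (intro bexI conjI)
      let ?\<Phi> = "(\<lambda>x. (B x, Q x)) ` K'"
      show "?\<Phi> \<in> Fpow (\<B> \<times> \<Q>)" using K' BQ by (auto simp: Fpow_def)
      show "f \<in> ?P ?\<Phi>" using K' BQ \<open>f \<in> cont_fun X\<close> by blast
      show "?P ?\<Phi> \<subseteq> s"
      proof
        fix g assume g: "g \<in> ?P ?\<Phi>"
        have "g y \<in> U" if y: "y \<in> K" for y
        proof -
          obtain x where x: "x \<in> K'" "y \<in> B x" using y K' by blast
          with g have "g y \<in> Q x" by auto
          with x K' BQ show ?thesis by blast
        qed
        with g show "g \<in> s" by (auto simp: KU(1))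
      qed
    qed
  qed
  then show ?thesis by auto
qed

text \<open>One function is chosen from each nonempty set of the network.\<close>

lemma compact_open_dense_subset:
  assumes "Hausdorff_space X" "infinite (topspace X)"
  obtains E where "E \<subseteq> cont_fun X" "|E| \<le>o topology_weight X"
    "\<And>W. openin (compact_open_topology X) W \<Longrightarrow> W \<noteq> {} \<Longrightarrow> E \<inter> W \<noteq> {}"
proof -
  obtain \<B> where base: "is_base X \<B>" and w: "topology_weight X = |\<B>|"
    using topology_weight[of X] by blast
  have inf: "infinite \<B>"
    using infinite_base_of_infinite_Hausdorff_space[OF assms base] .
  obtain \<Q> :: "real set set" where Q: "countable \<Q>" "topological_basis \<Q>"
    using ex_countable_basis by blast
  let ?P = "\<lambda>\<Phi>. {g \<in> cont_fun X. \<forall>(B, Q)\<in>\<Phi>. g ` B \<subseteq> Q}"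
  define pick where "pick \<Phi> = (SOME g. g \<in> ?P \<Phi>)" for \<Phi>
  define E where "E = pick ` {\<Phi> \<in> Fpow (\<B> \<times> \<Q>). ?P \<Phi> \<noteq> {}}"
  have pick: "pick \<Phi> \<in> ?P \<Phi>" if "?P \<Phi> \<noteq> {}" for \<Phi>
    using that by (simp only: pick_def some_in_eq not_False_eq_True)
  have ne: "\<Q> \<noteq> {}" using topological_basisE[OF Q(2) open_UNIV UNIV_I] by blast
  have "|\<Q>| \<le>o |\<B>|"
    using Q(1) inf unfolding countable_card_of_nat infinite_iff_card_of_nat
    by (rule ordLeq_transitive)
  with inf have "|\<B> \<times> \<Q>| \<le>o |\<B>|" by (intro card_of_Sigma_ordLeq_infinite) (auto simp: ordLeq_refl[OF card_of_Card_order])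
  moreover have "|Fpow (\<B> \<times> \<Q>)| \<le>o |\<B> \<times> \<Q>|"
    using inf ne by (intro card_of_Fpow_le) (auto simp: finite_cartesian_product_iff)
  moreover have "|E| \<le>o |Fpow (\<B> \<times> \<Q>)|"
    unfolding E_def by (rule ordLeq_transitive[OF card_of_image card_of_mono1]) auto
  ultimately have card: "|E| \<le>o topology_weight X"
    unfolding w by (meson ordLeq_transitive)
  have sub: "E \<subseteq> cont_fun X" using pick by (auto simp: E_def)
  have meets: "E \<inter> W \<noteq> {}" if W: "openin (compact_open_topology X) W" "W \<noteq> {}" for W
  proof -
    obtain f where f: "f \<in> W" using W by auto
    then have "f \<in> cont_fun X" using openin_subset[OF W(1)] by auto
    with compact_open_network[OF base Q(2) W(1) f]
    obtain \<Phi> where "\<Phi> \<in> Fpow (\<B> \<times> \<Q>)" "f \<in> ?P \<Phi>" "?P \<Phi> \<subseteq> W" by blast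
    moreover from this have "pick \<Phi> \<in> ?P \<Phi>" by (intro pick) blast
    ultimately show ?thesis unfolding E_def by blast
  qed
  show thesis by (rule that[OF sub card meets])
qed


section \<open>Disjoint open sets in a metric space\<close>

text \<open>Density of \<open>D\<close> in an open set \<open>U\<close>, expressed without passing to the subspace \<open>U\<close>.\<close>

definition dense_in :: "'a topology \<Rightarrow> 'a set \<Rightarrow> 'a set \<Rightarrow> bool" where
  "dense_in X U D \<longleftrightarrow> D \<subseteq> U \<and> (\<forall>V. openin X V \<and> V \<noteq> {} \<and> V \<subseteq> U \<longrightarrow> D \<inter> V \<noteq> {})"

definition cellular :: "'a topology \<Rightarrow> 'a set \<Rightarrow> 'a set set \<Rightarrow> bool" where
  "cellular X U \<C> \<longleftrightarrow> (\<forall>C\<in>\<C>. openin X C \<and> C \<noteq> {} \<and> C \<subseteq> U) \<and> pairwise disjnt \<C>"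

text \<open>Cellular families in disjoint sets \<open>U i\<close> have no common member, so their sizes add up to the
  size of the union.\<close>

lemma cellular_UNION:
  assumes disj: "\<And>i j. i \<in> I \<Longrightarrow> j \<in> I \<Longrightarrow> i \<noteq> j \<Longrightarrow> disjnt (U i) (U j)"
    and cell: "\<And>i. i \<in> I \<Longrightarrow> cellular X (U i) (\<C> i)"
    and le: "\<And>i. i \<in> I \<Longrightarrow> |D i| \<le>o |\<C> i|"
    and sub: "\<And>i. i \<in> I \<Longrightarrow> U i \<subseteq> W"
  shows "cellular X W (\<Union>i\<in>I. \<C> i)" and "|\<Union>i\<in>I. D i| \<le>o |\<Union>i\<in>I. \<C> i|"
proof -
  have sep: "disjnt C C'" if "i \<in> I" "j \<in> I" "i \<noteq> j" "C \<in> \<C> i" "C' \<in> \<C> j" for i j C C'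
    using disj[OF that(1-3)] cell[OF that(1)] cell[OF that(2)] that(4,5)
    unfolding cellular_def disjnt_iff by blast
  show "cellular X W (\<Union>i\<in>I. \<C> i)"
    unfolding cellular_def
  proof (intro conjI ballI)
    show "pairwise disjnt (\<Union>i\<in>I. \<C> i)"
      using sep cell unfolding pairwise_def cellular_def by (metis UN_E)
  qed (use cell sub in \<open>(fastforce simp: cellular_def)+\<close>)
  have "inj_on snd (SIGMA i:I. \<C> i)"
  proof (rule inj_onI, clarsimp)
    fix i j C assume "i \<in> I" "j \<in> I" "C \<in> \<C> i" "C \<in> \<C> j"
    moreover from this have "C \<noteq> {}" using cell unfolding cellular_def by blast
    ultimately show "i = j" using sep[of i j C C] by (auto simp: disjnt_iff)
  qed
  moreover have "snd ` (SIGMA i:I. \<C> i) \<subseteq> (\<Union>i\<in>I. \<C> i)" by auto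
  ultimately have "|SIGMA i:I. \<C> i| \<le>o |\<Union>i\<in>I. \<C> i|"
    using card_of_ordLeq by blast
  moreover have "|SIGMA i:I. D i| \<le>o |SIGMA i:I. \<C> i|"
    using le by (intro card_of_Sigma_mono1) blast
  ultimately show "|\<Union>i\<in>I. D i| \<le>o |\<Union>i\<in>I. \<C> i|"
    by (meson card_of_UNION_Sigma ordLeq_transitive)
qed

context Metric_space
begin

abbreviation separated :: "nat \<Rightarrow> 'a \<Rightarrow> 'a \<Rightarrow> bool" where
  "separated n x y \<equiv> inverse (Suc n) \<le> d x y"

text \<open>A maximal \<open>1/(n+1)\<close>-separated set is a \<open>1/(n+1)\<close>-net.\<close>

lemma dense_in_UN_maximal_separated:
  assumes "openin mtopology U"
    and "\<And>n. S n \<subseteq> U"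
    and max: "\<And>n x. x \<in> U \<Longrightarrow> x \<notin> S n \<Longrightarrow> \<exists>y\<in>S n. \<not> (separated n x y \<and> separated n y x)"
  shows "dense_in mtopology U (\<Union>n. S n)"
  unfolding dense_in_def
proof (intro conjI allI impI)
  fix V assume V: "openin mtopology V \<and> V \<noteq> {} \<and> V \<subseteq> U"
  then obtain x r where x: "x \<in> V" "r > 0" "mball x r \<subseteq> V"
    unfolding openin_mtopology by (metis ex_in_conv)
  obtain n where n: "inverse (Suc n) < r"
    using reals_Archimedean[OF \<open>r > 0\<close>] by auto
  show "(\<Union>n. S n) \<inter> V \<noteq> {}"
  proof (cases "x \<in> S n")
    case False
    then obtain y where y: "y \<in> S n" "\<not> (separated n x y \<and> separated n y x)"
      using max[of x n] x V by auto
    then have "d x y < r" using n by (auto simp: commute)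
    moreover have "x \<in> M" "y \<in> M"
      using y x V assms(2)[of n] openin_subset[OF assms(1)] by auto
    ultimately have "y \<in> V" using x by auto
    with y show ?thesis by blast
  qed (use x in blast)
qed (use assms in auto)

text \<open>Balls of half the separation radius.\<close>

lemma cellular_of_separated:
  assumes U: "openin mtopology U" and S: "S \<subseteq> U" "pairwise (separated n) S"
  shows "\<exists>\<C>. cellular mtopology U \<C> \<and> |S| \<le>o |\<C>|"
proof -
  define r where "r = inverse (real (Suc n)) / 2"
  have "r > 0" by (simp add: r_def)
  define B where "B x = mball x r \<inter> U" for x
  have M: "S \<subseteq> M" using S openin_subset[OF U] by auto
  have B: "x \<in> B x" if "x \<in> S" for x
    using that M S \<open>r > 0\<close> by (auto simp: B_def)
  have disj: "disjnt (B x) (B y)" if "x \<in> S" "y \<in> S" "x \<noteq> y" for x y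
  proof -
    have "r + r \<le> d x y" using S(2) that by (auto simp: r_def pairwise_def)
    then have "disjnt (mball x r) (mball y r)" using that M
      by (smt (verit, ccfv_threshold) commute disjnt_iff in_mball triangle)
    then show ?thesis by (auto simp: B_def disjnt_iff)
  qed
  have "inj_on B S"
  proof (rule inj_onI, rule ccontr)
    fix x y assume "x \<in> S" "y \<in> S" "B x = B y" "x \<noteq> y"
    with disj B show False by (metis disjnt_iff)
  qed
  then have "|S| \<le>o |B ` S|" using card_of_ordLeq by blast
  moreover have "cellular mtopology U (B ` S)"
    unfolding cellular_def
  proof (intro conjI ballI)
    show "pairwise disjnt (B ` S)" using disj by (auto simp: pairwise_def)
    fix C assume "C \<in> B ` S"
    then obtain x where "x \<in> S" "C = B x" by blast
    then show "C \<noteq> {}" using B by blast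
    show "openin mtopology C" "C \<subseteq> U" using U \<open>C = B x\<close> by (auto simp: B_def)
  qed
  ultimately show ?thesis by blast
qed

text \<open>Among the disjoint families of open sets staying away from a fixed point \<open>p\<close>, a maximal one
  cannot be finite: its members would all miss some ball around \<open>p\<close>, and a small ball around
  another point of that ball could be added.\<close>

lemma infinite_cellular:
  assumes U: "openin mtopology U" "U \<noteq> {}"
    and inf: "\<And>V. openin mtopology V \<Longrightarrow> V \<noteq> {} \<Longrightarrow> V \<subseteq> U \<Longrightarrow> infinite V"
  shows "\<exists>\<C>. cellular mtopology U \<C> \<and> infinite \<C>"
proof -
  obtain p where p: "p \<in> U" "p \<in> M" using U openin_subset[OF U(1)] by auto
  let ?S = "{V. openin mtopology V \<and> V \<noteq> {} \<and> V \<subseteq> U \<and> (\<exists>r>0. disjnt (mball p r) V)}"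
  obtain \<C> where C: "\<C> \<subseteq> ?S" "pairwise disjnt \<C>"
    and max: "\<And>V. V \<in> ?S \<Longrightarrow> V \<notin> \<C> \<Longrightarrow> \<exists>C\<in>\<C>. \<not> (disjnt V C \<and> disjnt C V)"
    using maximal_pairwise_subset[of ?S disjnt] by blast
  have "infinite \<C>"
  proof
    assume fin: "finite \<C>"
    obtain r where r: "\<And>C. C \<in> \<C> \<Longrightarrow> r C > 0 \<and> disjnt (mball p (r C)) C"
      using C(1) by (simp add: subset_iff) metis
    define r0 where "r0 = Min (insert 1 (r ` \<C>))"
    have r0: "r0 > 0" "\<And>C. C \<in> \<C> \<Longrightarrow> r0 \<le> r C"
      using fin r by (auto simp: r0_def)
    define W where "W = mball p r0 \<inter> U"
    have W: "openin mtopology W" "p \<in> W" "W \<subseteq> U" using U p r0 by (auto simp: W_def)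
    then have "infinite (W - {p})" using inf[of W] by auto
    then obtain z where z: "z \<in> W" "z \<noteq> p" by (metis Diff_iff finite.emptyI insert_iff ex_in_conv)
    have zM: "z \<in> M" using z by (auto simp: W_def)
    have dz: "d p z > 0" using z zM p by auto
    define V where "V = mball z (d p z / 2) \<inter> W"
    have "disjnt (mball p (d p z / 2)) V"
      using zM p unfolding disjnt_iff V_def
      by (smt (verit, ccfv_threshold) Int_iff commute field_sum_of_halves in_mball triangle)
    moreover have "z \<in> V" using z zM dz by (auto simp: V_def)
    moreover have "openin mtopology V" "V \<subseteq> U" using W by (auto simp: V_def)
    ultimately have V: "V \<in> ?S" using dz by (auto intro!: exI[of _ "d p z / 2"])
    have "disjnt V C" if "C \<in> \<C>" for C
    proof -
      have "V \<subseteq> mball p (r C)"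
        using r0(2)[OF that] by (force simp: V_def W_def)
      then show ?thesis using r[OF that] by (auto simp: disjnt_iff)
    qed
    moreover from this have "V \<notin> \<C>" using \<open>z \<in> V\<close> by (auto simp: disjnt_iff)
    ultimately show False using max[OF V] by (auto simp: disjnt_sym)
  qed
  moreover have "cellular mtopology U \<C>"
    using C by (auto simp: cellular_def)
  ultimately show ?thesis by blast
qed

text \<open>The case that carries the construction is that of uncountable \<open>D\<close> with all \<open>1/n\<close>-separated sets
  \<open>S n\<close> smaller than \<open>D\<close> (so \<open>|D|\<close> has countable cofinality). Choose disjoint open sets \<open>G n\<close> inside
  \<open>U\<close>. By minimality each \<open>G n\<close> still has density at least \<open>|D|\<close>, which exceeds \<open>|S n|\<close>; so it contains a
  separated set, at some scale, of size at least \<open>|S n|\<close>. Collected over \<open>n\<close>, these give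
  as many disjoint open sets as the dense set \<open>\<Union>n. S n\<close> has points.\<close>

lemma cellular_of_homogeneous:
  assumes U: "openin mtopology U" "U \<noteq> {}" and D: "dense_in mtopology U D"
    and min: "\<And>V A. openin mtopology V \<Longrightarrow> V \<noteq> {} \<Longrightarrow> V \<subseteq> U \<Longrightarrow> dense_in mtopology V A \<Longrightarrow> |D| \<le>o |A|"
  shows "\<exists>\<C>. cellular mtopology U \<C> \<and> |D| \<le>o |\<C>|"
proof (cases "finite D")
  case True
  \<comment> \<open>A finite dense set isolates its points, and an isolated point has density one.\<close>
  have "D \<inter> U \<noteq> {}" using U D by (auto simp: dense_in_def)
  then obtain x where x: "x \<in> D" "x \<in> U" by auto
  define V where "V = U - (D - {x})"
  have "D - {x} \<subseteq> M" using D openin_subset[OF U(1)] by (auto simp: dense_in_def)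
  then have "closedin mtopology (D - {x})"
    using True closedin_Hausdorff_finite[OF Hausdorff_space_mtopology] by simp
  then have V: "openin mtopology V" "x \<in> V" "V \<subseteq> U"
    using U x by (auto simp: V_def)
  have "dense_in mtopology V {x}"
    unfolding dense_in_def
  proof (intro conjI allI impI)
    fix W assume W: "openin mtopology W \<and> W \<noteq> {} \<and> W \<subseteq> V"
    then have "D \<inter> W \<noteq> {}"
      using D V(3) unfolding dense_in_def by (meson order_trans)
    then show "{x} \<inter> W \<noteq> {}" using W by (auto simp: V_def)
  qed (use V in auto)
  then have "|D| \<le>o |{x}|" using min[of V "{x}"] V by auto
  also have "|{x}| \<le>o |{U}|" by (rule surj_imp_ordLeq[of _ "\<lambda>_. x"]) auto
  finally show ?thesis using U by (intro exI[of _ "{U}"]) (auto simp: cellular_def)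
next
  case False
  have inf: "infinite V" if "openin mtopology V" "V \<noteq> {}" "V \<subseteq> U" for V
  proof -
    have "|D| \<le>o |V|" using that by (intro min) (auto simp: dense_in_def)
    then show ?thesis using False card_of_ordLeq_infinite by blast
  qed
  obtain \<G> where G: "cellular mtopology U \<G>" "infinite \<G>"
    using infinite_cellular[OF U inf] by blast
  show ?thesis
  proof (cases "countable D")
    case True
    then have "|D| \<le>o |\<G>|"
      using G(2) by (meson countable_card_of_nat infinite_iff_card_of_nat ordLeq_transitive)
    with G show ?thesis by blast
  next
    case unc: False
    have exS: "\<exists>S. S \<subseteq> V \<and> pairwise (separated n) S \<and>
        (\<forall>x\<in>V. x \<notin> S \<longrightarrow> (\<exists>y\<in>S. \<not> (separated n x y \<and> separated n y x)))" for V n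
      by (rule maximal_pairwise_subset[of V "separated n"]) blast
    obtain S where S: "\<And>n. S n \<subseteq> U" "\<And>n. pairwise (separated n) (S n)"
      "\<And>n x. x \<in> U \<Longrightarrow> x \<notin> S n \<Longrightarrow> \<exists>y\<in>S n. \<not> (separated n x y \<and> separated n y x)"
      using exS[of U] by metis
    show ?thesis
    proof (cases "\<exists>n. |D| \<le>o |S n|")
      case True
      then show ?thesis using cellular_of_separated[OF U(1) S(1,2)] ordLeq_transitive by blast
    next
      case False
      then have small: "|S n| <o |D|" for n
        by (meson not_ordLeq_iff_ordLess card_of_Well_order)
      obtain G :: "nat \<Rightarrow> 'a set" where G': "inj G" "range G \<subseteq> \<G>"
        using G(2) infinite_countable_subset by blast
      have Gop: "openin mtopology (G n)" "G n \<noteq> {}" "G n \<subseteq> U" for n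
        using G(1) G'(2) by (auto simp: cellular_def)
      have Gdis: "disjnt (G i) (G j)" if "i \<noteq> j" for i j
        using G(1) G' that unfolding cellular_def pairwise_def by (metis injD range_subsetD)
      have "\<exists>\<C>. cellular mtopology (G n) \<C> \<and> |S n| \<le>o |\<C>|" for n
      proof -
        obtain R where R: "\<And>m. R m \<subseteq> G n" "\<And>m. pairwise (separated m) (R m)"
          "\<And>m x. x \<in> G n \<Longrightarrow> x \<notin> R m \<Longrightarrow> \<exists>y\<in>R m. \<not> (separated m x y \<and> separated m y x)"
          using exS[of "G n"] by metis
        \<comment> \<open>Otherwise \<open>G n\<close> would have a dense subset smaller than \<open>D\<close>. The summand \<open>nat\<close> covers the
          countable union in case \<open>S n\<close> is finite.\<close>
        have "\<exists>m. |S n| \<le>o |R m|"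
        proof (rule ccontr)
          assume "\<not> ?thesis"
          then have "|R m| \<le>o |S n|" for m
            by (meson not_ordLeq_iff_ordLess card_of_Well_order ordLess_imp_ordLeq)
          then have "|R m| \<le>o |S n <+> (UNIV :: nat set)|" for m
            using card_of_Plus1 ordLeq_transitive by blast
          then have "|\<Union>m. R m| \<le>o |S n <+> (UNIV :: nat set)|"
            by (intro card_of_UNION_ordLeq_infinite) (auto simp: card_of_Plus2)
          moreover have "|UNIV :: nat set| <o |D|"
            using unc by (meson countable_card_of_nat not_ordLeq_iff_ordLess card_of_Well_order)
          then have "|S n <+> (UNIV :: nat set)| <o |D|"
            using card_of_Plus_ordLess_infinite[OF \<open>infinite D\<close> small] by blast
          ultimately have "|\<Union>m. R m| <o |D|" by (rule ordLeq_ordLess_trans)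
          moreover have "|D| \<le>o |\<Union>m. R m|"
            by (rule min[OF Gop dense_in_UN_maximal_separated[OF Gop(1) R(1,3)]])
          ultimately show False using not_ordLess_ordLeq by blast
        qed
        then show ?thesis
          using cellular_of_separated[OF Gop(1) R(1,2)] ordLeq_transitive by blast
      qed
      then obtain \<C> where C: "\<And>n. cellular mtopology (G n) (\<C> n)" "\<And>n. |S n| \<le>o |\<C> n|"
        by metis
      have "cellular mtopology U (\<Union>n. \<C> n)" "|\<Union>n. S n| \<le>o |\<Union>n. \<C> n|"
        using cellular_UNION[of UNIV G mtopology \<C> S U] C Gdis Gop(3) by auto
      moreover have "|D| \<le>o |\<Union>n. S n|"
        by (rule min[OF U order_refl dense_in_UN_maximal_separated[OF U(1) S(1,3)]])
      ultimately show ?thesis using ordLeq_transitive by blast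
    qed
  qed
qed

text \<open>Every nonempty open set contains one whose density is least among its own nonempty
  open subsets, to which the preceding lemma applies;
  a maximal disjoint family of open sets obtained in this way has dense union.\<close>

lemma cellular_ge_density:
  "\<exists>\<C> D. cellular mtopology M \<C> \<and> dense_in mtopology M D \<and> |D| \<le>o |\<C>|"
proof -
  let ?good = "{U. openin mtopology U \<and> U \<noteq> {} \<and>
    (\<exists>D \<C>. dense_in mtopology U D \<and> cellular mtopology U \<C> \<and> |D| \<le>o |\<C>| )}"
  have good: "\<exists>U\<in>?good. U \<subseteq> W" if W: "openin mtopology W" "W \<noteq> {}" for W
  proof -
    let ?\<A> = "{A. \<exists>V. openin mtopology V \<and> V \<noteq> {} \<and> V \<subseteq> W \<and> dense_in mtopology V A}"
    have "W \<in> ?\<A>" using W by (auto simp: dense_in_def)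
    then obtain D where "D \<in> ?\<A>" and min: "\<And>B. B \<in> ?\<A> \<Longrightarrow> |D| \<le>o |B|"
      using least_card[of ?\<A>] by blast
    then obtain U where U: "openin mtopology U" "U \<noteq> {}" "U \<subseteq> W" "dense_in mtopology U D"
      by blast
    have "|D| \<le>o |A|" if "openin mtopology V" "V \<noteq> {}" "V \<subseteq> U" "dense_in mtopology V A" for V A
      using that U(3) by (intro min) blast
    then have "\<exists>\<C>. cellular mtopology U \<C> \<and> |D| \<le>o |\<C>|"
      by (rule cellular_of_homogeneous[OF U(1,2,4)])
    with U show ?thesis by blast
  qed
  obtain \<O> where O: "\<O> \<subseteq> ?good" "pairwise disjnt \<O>"
    and max: "\<And>U. U \<in> ?good \<Longrightarrow> U \<notin> \<O> \<Longrightarrow> \<exists>V\<in>\<O>. \<not> (disjnt U V \<and> disjnt V U)"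
    using maximal_pairwise_subset[of ?good disjnt] by blast
  have "\<exists>D \<C>. dense_in mtopology U D \<and> cellular mtopology U \<C> \<and> |D| \<le>o |\<C>|" if "U \<in> \<O>" for U
    using O(1) that by blast
  then obtain D \<C> where DC: "\<And>U. U \<in> \<O> \<Longrightarrow> dense_in mtopology U (D U)"
      "\<And>U. U \<in> \<O> \<Longrightarrow> cellular mtopology U (\<C> U)" "\<And>U. U \<in> \<O> \<Longrightarrow> |D U| \<le>o |\<C> U|"
    by metis
  have OM: "U \<subseteq> M" if "U \<in> \<O>" for U
    using O(1) that openin_subset[of mtopology U] by auto
  have "cellular mtopology M (\<Union>U\<in>\<O>. \<C> U)" "|\<Union>U\<in>\<O>. D U| \<le>o |\<Union>U\<in>\<O>. \<C> U|"
    using cellular_UNION[of \<O> "\<lambda>U. U" mtopology \<C> D M] DC O(2) OM by (auto simp: pairwise_def)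
  moreover have "dense_in mtopology M (\<Union>U\<in>\<O>. D U)"
    unfolding dense_in_def
  proof (intro conjI allI impI)
    fix V assume V: "openin mtopology V \<and> V \<noteq> {} \<and> V \<subseteq> M"
    then obtain U' where U': "U' \<in> ?good" "U' \<subseteq> V" using good[of V] by auto
    have "\<exists>U\<in>\<O>. U \<inter> U' \<noteq> {}"
    proof (cases "U' \<in> \<O>")
      case False
      with max[OF U'(1)] show ?thesis by (auto simp: disjnt_def)
    qed (use U' in auto)
    then obtain U where U: "U \<in> \<O>" "U \<inter> V \<noteq> {}" using U'(2) by blast
    then have "openin mtopology (U \<inter> V)" using O(1) V by blast
    then have "D U \<inter> (U \<inter> V) \<noteq> {}"
      using DC(1)[OF U(1)] U(2) unfolding dense_in_def by (meson inf_le1)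
    with U show "(\<Union>U\<in>\<O>. D U) \<inter> V \<noteq> {}" by blast
  qed (use DC(1) OM in \<open>force simp: dense_in_def\<close>)
  ultimately show ?thesis by blast
qed

end


section \<open>Lipschitz functions supported on disjoint open sets\<close>

text \<open>Take \<open>\<J>\<close> maximal with the stated property, and let \<open>\<T>\<close> be the family of sets that contain \<open>y C\<close> for
  some \<open>C \<in> \<J>\<close>. If \<open>\<J>\<close> is too small, then so is \<open>\<T>\<close>, and the rest \<open>\<K>\<close> has full size. By maximality
  \<open>y\<close> sends each member of \<open>\<K>\<close> into a member of \<open>\<J>\<close>, hence into no member of \<open>\<K>\<close>.\<close>

lemma disjoint_family_thinning:
  assumes inf: "infinite \<C>" and disj: "pairwise disjnt \<C>"
  obtains \<J> where "\<J> \<subseteq> \<C>" "|\<C>| \<le>o |\<J>|"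
    "\<And>C C'. C \<in> \<J> \<Longrightarrow> C' \<in> \<J> \<Longrightarrow> C \<noteq> C' \<Longrightarrow> y C \<notin> C'"
proof -
  obtain \<J> where J: "\<J> \<subseteq> \<C>" "pairwise (\<lambda>C C'. y C \<notin> C') \<J>"
    and max: "\<And>C. C \<in> \<C> \<Longrightarrow> C \<notin> \<J> \<Longrightarrow> \<exists>C'\<in>\<J>. \<not> (y C \<notin> C' \<and> y C' \<notin> C)"
    using maximal_pairwise_subset[of \<C> "\<lambda>C C'. y C \<notin> C'"] by blast
  define \<T> where "\<T> = {C' \<in> \<C>. \<exists>C\<in>\<J>. y C \<in> C'}"
  define \<K> where "\<K> = \<C> - (\<J> \<union> \<T>)"
  have uniq: "C = C'" if "C \<in> \<C>" "C' \<in> \<C>" "z \<in> C" "z \<in> C'" for C C' z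
    using disj that by (meson disjnt_iff pairwiseD)
  have "\<T> \<subseteq> (\<lambda>C. THE C'. C' \<in> \<C> \<and> y C \<in> C') ` \<J>"
  proof
    fix C' assume "C' \<in> \<T>"
    then obtain C where C: "C \<in> \<J>" "C' \<in> \<C>" "y C \<in> C'" by (auto simp: \<T>_def)
    then have "C' = (THE C'. C' \<in> \<C> \<and> y C \<in> C')"
      by (intro the_equality[symmetric]) (simp, metis uniq)
    then show "C' \<in> (\<lambda>C. THE C'. C' \<in> \<C> \<and> y C \<in> C') ` \<J>" using C(1) by (rule image_eqI)
  qed
  then have T: "|\<T>| \<le>o |\<J>|"
    by (meson card_of_image card_of_mono1 ordLeq_transitive)
  have K: "y C \<notin> C'" if C: "C \<in> \<K>" "C' \<in> \<K>" for C C'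
  proof
    assume "y C \<in> C'"
    obtain C'' where "C'' \<in> \<J>" "y C \<in> C'' \<or> y C'' \<in> C"
      using max[of C] C by (auto simp: \<K>_def)
    moreover have "y C'' \<notin> C" using C \<open>C'' \<in> \<J>\<close> by (auto simp: \<K>_def \<T>_def)
    ultimately have "C'' = C'"
      using uniq[of C'' C' "y C"] C J(1) \<open>y C \<in> C'\<close> by (auto simp: \<K>_def)
    with \<open>C'' \<in> \<J>\<close> C show False by (auto simp: \<K>_def)
  qed
  have "|\<C>| \<le>o |\<J>| \<or> |\<C>| \<le>o |\<K>|"
  proof (rule ccontr)
    assume "\<not> ?thesis"
    then have lt: "|\<J>| <o |\<C>|" "|\<K>| <o |\<C>|"
      by (meson not_ordLeq_iff_ordLess card_of_Well_order)+
    moreover have "|\<T>| <o |\<C>|" using T lt(1) by (rule ordLeq_ordLess_trans)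
    ultimately have "|(\<J> \<union> \<T>) \<union> \<K>| <o |\<C>|"
      by (intro card_of_Un_ordLess_infinite[OF inf])
    moreover have "(\<J> \<union> \<T>) \<union> \<K> = \<C>" using J(1) by (auto simp: \<K>_def \<T>_def)
    ultimately show False using ordLess_irreflexive by metis
  qed
  then show thesis
  proof
    assume "|\<C>| \<le>o |\<J>|"
    then show thesis using J by (intro that[of \<J>]) (auto simp: pairwise_def)
  next
    assume "|\<C>| \<le>o |\<K>|"
    then show thesis using K by (intro that[of \<K>]) (auto simp: \<K>_def)
  qed
qed

context Metric_space
begin

text \<open>Any other point close enough to \<open>x\<close> serves as \<open>y\<close>. If there is none, then \<open>x\<close> is isolated and an
  almost nearest point \<open>y\<close> serves, as the ball of radius \<open>d x y / 2\<close> is just \<open>{x}\<close>; in this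
  case \<open>y\<close> may lie outside \<open>U\<close>.\<close>

lemma half_distance_ball_in_open:
  assumes U: "openin mtopology U" "x \<in> U" and ne: "M - {x} \<noteq> {}"
  shows "\<exists>y\<in>M. y \<noteq> x \<and> mball x (d x y / 2) \<subseteq> U"
proof -
  obtain \<rho> where \<rho>: "\<rho> > 0" "mball x \<rho> \<subseteq> U"
    using U by (meson openin_mtopology)
  have xM: "x \<in> M" using U openin_subset by fastforce
  show ?thesis
  proof (cases "\<exists>y\<in>M. y \<noteq> x \<and> d x y < 2 * \<rho>")
    case True
    then obtain y where y: "y \<in> M" "y \<noteq> x" "d x y < 2 * \<rho>" by blast
    then have "mball x (d x y / 2) \<subseteq> mball x \<rho>" by (intro mball_subset_concentric) auto
    with y \<rho> show ?thesis by blast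
  next
    case False
    \<comment> \<open>\<open>x\<close> is isolated, at distance \<open>s > 0\<close> from the other points.\<close>
    define s where "s = Inf (d x ` (M - {x}))"
    have bdd: "bdd_below (d x ` (M - {x}))" by (auto intro!: bdd_belowI[of _ 0])
    have "2 * \<rho> \<le> s"
      unfolding s_def using ne False by (intro cINF_greatest) auto
    then have "Inf (d x ` (M - {x})) < 2 * s" using \<rho> by (simp add: s_def)
    then obtain y where y: "y \<in> M" "y \<noteq> x" "d x y < 2 * s"
      using cInf_lessD[of "d x ` (M - {x})"] ne by auto
    have "z = x" if "z \<in> mball x (d x y / 2)" for z
    proof (rule ccontr)
      assume "z \<noteq> x"
      then have "s \<le> d x z" unfolding s_def using that bdd by (intro cINF_lower) auto
      with that y show False by auto
    qed
    then have "mball x (d x y / 2) \<subseteq> U" using U by blast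
    with y show ?thesis by blast
  qed
qed

definition tent :: "'a \<Rightarrow> real \<Rightarrow> 'a \<Rightarrow> real" where
  "tent x r z = max 0 (r - d x z)"

lemma tent_le: "x \<in> M \<Longrightarrow> z \<in> M \<Longrightarrow> w \<in> M \<Longrightarrow> tent x r z \<le> tent x r w + d z w"
  using triangle[of x z w] triangle[of x w z] unfolding tent_def by (auto simp: commute)

text \<open>The tent of the member of \<open>\<A>\<close> containing \<open>z\<close>, evaluated at \<open>z\<close>. This is meant for disjoint
  \<open>\<A>\<close>, where the member is unique.\<close>

definition tents :: "('a set \<Rightarrow> 'a) \<Rightarrow> ('a set \<Rightarrow> real) \<Rightarrow> 'a set set \<Rightarrow> 'a \<Rightarrow> real" where
  "tents x r \<A> z =
     (if z \<in> \<Union>\<A> then let C = (THE C. C \<in> \<A> \<and> z \<in> C) in tent (x C) (r C) z else 0)"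

lemma tents_eq:
  assumes "pairwise disjnt \<A>" "C \<in> \<A>" "z \<in> C"
  shows "tents x r \<A> z = tent (x C) (r C) z"
proof -
  have "(THE C. C \<in> \<A> \<and> z \<in> C) = C"
    using assms by (intro the_equality) (auto simp: pairwise_def disjnt_iff)
  then show ?thesis using assms by (auto simp: tents_def)
qed

text \<open>The tents are \<open>1\<close>-Lipschitz, nonnegative and disjointly supported, so \<open>tents x r \<A>\<close> is their
  pointwise supremum, which is again \<open>1\<close>-Lipschitz.\<close>

lemma tents_Lipschitz:
  assumes disj: "pairwise disjnt \<A>"
    and x: "\<And>C. C \<in> \<A> \<Longrightarrow> x C \<in> M" and sub: "\<And>C. C \<in> \<A> \<Longrightarrow> mball (x C) (r C) \<subseteq> C"
    and zw: "z \<in> M" "w \<in> M"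
  shows "\<bar>tents x r \<A> z - tents x r \<A> w\<bar> \<le> d z w"
proof -
  have nonneg: "0 \<le> tents x r \<A> z" for z
    by (simp add: tents_def Let_def tent_def)
  have "tents x r \<A> z \<le> tents x r \<A> w + d z w" if "z \<in> M" "w \<in> M" for z w
  proof (cases "z \<in> \<Union>\<A>")
    case True
    then obtain C where C: "C \<in> \<A>" "z \<in> C" by blast
    have "tent (x C) (r C) w \<le> tents x r \<A> w"
    proof (cases "w \<in> C")
      case False
      then have "w \<notin> mball (x C) (r C)" using sub C by blast
      then have "tent (x C) (r C) w = 0" using x C that by (auto simp: tent_def)
      then show ?thesis using nonneg by simp
    qed (use C tents_eq[OF disj] in simp)
    moreover have "tents x r \<A> z \<le> tent (x C) (r C) w + d z w"
      using tents_eq[OF disj C] tent_le[of "x C" z w "r C"] x C that by simp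
    ultimately show ?thesis by linarith
  qed (use nonneg[of w] in \<open>simp add: tents_def\<close>)
  from this[OF zw] this[OF zw(2,1)] show ?thesis by (simp add: commute abs_le_iff)
qed

end

text \<open>On each set \<open>C\<close> of a disjoint family, a tent of height \<open>d(p C, q C) / 2\<close> is erected at \<open>p C\<close>; it vanishes at
  \<open>q C\<close>. Since \<open>q C\<close> may lie in another member of the family, the family is thinned
  first, so that no other tent interferes at \<open>q C\<close>.\<close>

lemma Lip0_separating_pairs:
  assumes inf: "infinite (mspace N)" and e: "e \<in> mspace N"
  obtains \<J> :: "'b set set" and p q :: "'b set \<Rightarrow> 'b" where
    "infinite \<J>" "topology_density (mtopology_of N) \<le>o |\<J>|"
    "\<And>C. C \<in> \<J> \<Longrightarrow> p C \<in> mspace N \<and> q C \<in> mspace N \<and> p C \<noteq> q C"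
    "\<And>\<A>. \<A> \<subseteq> \<J> \<Longrightarrow> \<exists>f\<in>Lip0 N e. \<forall>C\<in>\<J>.
       (f (p C) - f (q C)) / mdist N (p C) (q C) = (if C \<in> \<A> then 1/2 else 0)"
proof -
  interpret Metric_space "mspace N" "mdist N" by simp
  have top: "mtopology_of N = mtopology" by (simp add: mtopology_of_def)
  obtain \<C> D where C: "cellular mtopology (mspace N) \<C>"
    and D: "dense_in mtopology (mspace N) D" "|D| \<le>o |\<C>|"
    using cellular_ge_density by blast
  have "is_dense mtopology D"
    using D(1) unfolding is_dense_def dense_intersects_open dense_in_def
    by (metis openin_subset topspace_mtopology)
  then have dens: "topology_density (mtopology_of N) \<le>o |D|"
    using topology_density[of mtopology] unfolding top by metis
  have "infinite D"
  proof
    assume "finite D"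
    moreover have "D \<subseteq> mspace N" using D by (auto simp: dense_in_def)
    ultimately have "closedin mtopology D"
      using closedin_Hausdorff_finite[OF Hausdorff_space_mtopology] by simp
    then have "D = mspace N"
      using \<open>is_dense mtopology D\<close> by (simp add: is_dense_def closure_of_closedin)
    with inf \<open>finite D\<close> show False by simp
  qed
  then have infC: "infinite \<C>" by (rule card_of_ordLeq_infinite[OF D(2)])
  have "\<exists>x y. x \<in> C \<and> y \<in> mspace N \<and> y \<noteq> x \<and> mball x (mdist N x y / 2) \<subseteq> C" if CC: "C \<in> \<C>" for C
  proof -
    have "C \<noteq> {}" using C CC by (auto simp: cellular_def)
    then obtain x where "x \<in> C" by auto
    moreover have "mspace N - {x} \<noteq> {}"
      using infinite_remove[OF inf, of x] by (metis finite.emptyI)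
    moreover have "openin mtopology C" using C CC by (auto simp: cellular_def)
    ultimately show ?thesis
      using half_distance_ball_in_open[of C x] by metis
  qed
  then obtain p q where pq: "\<And>C. C \<in> \<C> \<Longrightarrow> p C \<in> C \<and> q C \<in> mspace N \<and> q C \<noteq> p C \<and>
      mball (p C) (mdist N (p C) (q C) / 2) \<subseteq> C"
    by metis
  have disj: "pairwise disjnt \<C>" using C by (simp add: cellular_def)
  obtain \<J> where J: "\<J> \<subseteq> \<C>" "|\<C>| \<le>o |\<J>|"
      "\<And>C C'. C \<in> \<J> \<Longrightarrow> C' \<in> \<J> \<Longrightarrow> C \<noteq> C' \<Longrightarrow> q C \<notin> C'"
    using disjoint_family_thinning[OF infC disj, of q] by blast
  have pM: "p C \<in> mspace N" if "C \<in> \<J>" for C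
    using pq J(1) C that unfolding cellular_def by blast
  define r where "r C = mdist N (p C) (q C) / 2" for C
  show thesis
  proof (rule that)
    show "infinite \<J>" by (rule card_of_ordLeq_infinite[OF J(2) infC])
    show "topology_density (mtopology_of N) \<le>o |\<J>|"
      by (rule ordLeq_transitive[OF ordLeq_transitive[OF dens D(2)] J(2)])
    show "p C \<in> mspace N \<and> q C \<in> mspace N \<and> p C \<noteq> q C" if "C \<in> \<J>" for C
      using pq[of C] J(1) that pM by auto
    fix \<A> assume A: "\<A> \<subseteq> \<J>"
    then have dA: "pairwise disjnt \<A>" using disj J(1) by (meson pairwise_subset order_trans)
    define f where "f = (\<lambda>z\<in>mspace N. tents p r \<A> z - tents p r \<A> e)"
    have lip: "\<bar>tents p r \<A> z - tents p r \<A> w\<bar> \<le> mdist N z w"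
      if "z \<in> mspace N" "w \<in> mspace N" for z w
      using that A J(1) pq pM unfolding r_def by (intro tents_Lipschitz[OF dA]) (blast+)
    have "f \<in> Lip0 N e"
      using e lip unfolding Lip0_def Lipschitz_continuous_map_def
      by (auto simp: f_def dist_real_def intro!: exI[of _ 1])
    moreover have "(f (p C) - f (q C)) / mdist N (p C) (q C) = (if C \<in> \<A> then 1/2 else 0)"
      if CJ: "C \<in> \<J>" for C
    proof -
      have C': "C \<in> \<C>" using CJ J(1) by blast
      have pos: "mdist N (p C) (q C) > 0" using pq[OF C'] pM[OF CJ] by (metis mdist_pos_eq)
      have "q C \<notin> C'" if "C' \<in> \<A>" "C' \<noteq> C" for C' using J(3)[OF CJ] A that by blast
      have "tents p r \<A> (q C) = 0"
      proof (cases "C \<in> \<A> \<and> q C \<in> C")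
        case True
        then have "tents p r \<A> (q C) = tent (p C) (r C) (q C)" by (intro tents_eq[OF dA]) auto
        then show ?thesis using pos by (simp add: tent_def r_def)
      next
        case False
        then have "q C \<notin> \<Union>\<A>" using \<open>\<And>C'. C' \<in> \<A> \<Longrightarrow> C' \<noteq> C \<Longrightarrow> q C \<notin> C'\<close> by blast
        then show ?thesis by (simp add: tents_def)
      qed
      then have "f (q C) = - tents p r \<A> e" using pq[OF C'] by (simp only: f_def restrict_apply' diff_0)
      moreover have "tents p r \<A> (p C) = (if C \<in> \<A> then r C else 0)"
      proof (cases "C \<in> \<A>")
        case True
        then show ?thesis using tents_eq[OF dA True, of "p C"] pq[OF C'] pM[OF CJ] pos
          by (simp add: tent_def r_def)
      next
        case False
        then have "p C \<notin> \<Union>\<A>" using pq[OF C'] disj A J(1) C'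
          by (metis Union_iff disjnt_iff pairwiseD subsetD)
        with False show ?thesis by (simp add: tents_def)
      qed
      then have "f (p C) = (if C \<in> \<A> then r C else 0) - tents p r \<A> e"
        using pM[OF CJ] by (simp only: f_def restrict_apply')
      ultimately show ?thesis
        using pos by (simp add: r_def)
    qed
    ultimately show "\<exists>f\<in>Lip0 N e. \<forall>C\<in>\<J>.
        (f (p C) - f (q C)) / mdist N (p C) (q C) = (if C \<in> \<A> then 1/2 else 0)"
      by (intro bexI[of _ f] ballI)
  qed
qed


section \<open>Weakly dense sets of Lipschitz functions\<close>

text \<open>Each \<open>A \<subseteq> I\<close> is recovered from the finite set \<open>F\<close> separating it from its complement and
  from the finitely many patterns \<open>{g \<in> F. p i g > m}\<close> realised by \<open>i \<in> A\<close>: an index with the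
  same pattern as some \<open>i \<in> A\<close> cannot lie outside \<open>A\<close>. There are at most \<open>|D|\<close> such codes.\<close>

lemma card_of_Pow_le_of_finite_separation:
  fixes p :: "'i \<Rightarrow> 'c \<Rightarrow> real"
  assumes inf: "infinite I"
    and sep: "\<And>A. A \<subseteq> I \<Longrightarrow> \<exists>F. finite F \<and> F \<subseteq> D \<and> (\<forall>i\<in>A. \<forall>j\<in>I - A. \<exists>g\<in>F. p i g > m \<and> p j g < m)"
  shows "|Pow I| \<le>o |D|"
proof -
  obtain F where F: "\<And>A. A \<subseteq> I \<Longrightarrow> finite (F A) \<and> F A \<subseteq> D \<and> (\<forall>i\<in>A. \<forall>j\<in>I - A. \<exists>g\<in>F A. p i g > m \<and> p j g < m)"
    using sep by metis
  define pat where "pat A i = {g \<in> F A. p i g > m}" for A i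
  define code where "code A = (F A, pat A ` A)" for A
  have decode: "A = {j \<in> I. pat A j \<in> pat A ` A}" if A: "A \<subseteq> I" for A
  proof (intro equalityI subsetI CollectI conjI)
    fix j assume "j \<in> {j \<in> I. pat A j \<in> pat A ` A}"
    then obtain i where i: "j \<in> I" "i \<in> A" "pat A j = pat A i" by auto
    show "j \<in> A"
    proof (rule ccontr)
      assume "j \<notin> A"
      then obtain g where "g \<in> F A" "p i g > m" "p j g < m" using F[OF A] i \<open>j \<notin> A\<close> by blast
      then have "g \<in> pat A i" "g \<notin> pat A j" by (auto simp: pat_def)
      with i show False by simp
    qed
  qed (use A in auto)
  have "inj_on code (Pow I)"
  proof (rule inj_onI)
    fix A B assume "A \<in> Pow I" "B \<in> Pow I" and eq: "code A = code B"
    moreover from eq have "pat A = pat B" by (auto simp: code_def pat_def fun_eq_iff)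
    ultimately show "A = B" using decode[of A] decode[of B] by (auto simp: code_def)
  qed
  moreover have "code ` Pow I \<subseteq> Fpow D \<times> Fpow (Fpow D)"
  proof
    fix c assume "c \<in> code ` Pow I"
    then obtain A where A: "A \<subseteq> I" "c = code A" by auto
    have "pat A ` A \<subseteq> Pow (F A)" by (auto simp: pat_def)
    with F[OF A(1)] have "finite (pat A ` A)" by (meson finite_Pow_iff finite_subset)
    with F[OF A(1)] show "c \<in> Fpow D \<times> Fpow (Fpow D)"
      by (auto simp: A(2) code_def Fpow_def pat_def intro: finite_subset)
  qed
  ultimately have le: "|Pow I| \<le>o |Fpow D \<times> Fpow (Fpow D)|"
    using card_of_ordLeq by blast
  have "infinite D"
  proof
    assume "finite D"
    then have "finite (Fpow D \<times> Fpow (Fpow D))"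
      by (intro finite_cartesian_product) (auto intro!: finite_subset[OF Fpow_subset_Pow])
    with le have "finite (Pow I)" by (rule card_of_ordLeq_finite)
    with inf show False by simp
  qed
  then have 1: "|Fpow D| \<le>o |D|" by (rule card_of_Fpow_le)
  have "infinite (Fpow D)"
  proof
    assume "finite (Fpow D)"
    moreover have "(\<lambda>d. {d}) ` D \<subseteq> Fpow D" by (auto simp: Fpow_def)
    ultimately have "finite ((\<lambda>d. {d}) ` D)" by (rule finite_subset[rotated])
    with \<open>infinite D\<close> show False by (auto dest!: finite_imageD intro: inj_onI)
  qed
  then have "|Fpow (Fpow D)| \<le>o |D|"
    using card_of_Fpow_le 1 ordLeq_transitive by blast
  with 1 \<open>infinite D\<close> have "|Fpow D \<times> Fpow (Fpow D)| \<le>o |D|"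
    by (simp add: card_of_Sigma_ordLeq_infinite)
  with le show ?thesis by (rule ordLeq_transitive)
qed

text \<open>A finite subcover of \<open>K1 \<times> K0\<close> by the open rectangles belonging to the elements of \<open>D\<close>.\<close>

lemma finite_separation_of_compact:
  fixes L D :: "'c set" and m :: real
  defines "P \<equiv> product_topology (\<lambda>_. euclideanreal) L"
  assumes K: "compactin P K1" "compactin P K0" and D: "D \<subseteq> L"
    and sep: "\<And>\<phi> \<psi>. \<phi> \<in> K1 \<Longrightarrow> \<psi> \<in> K0 \<Longrightarrow> \<exists>g\<in>D. \<phi> g > m \<and> \<psi> g < m"
  shows "\<exists>F. finite F \<and> F \<subseteq> D \<and> (\<forall>\<phi>\<in>K1. \<forall>\<psi>\<in>K0. \<exists>g\<in>F. \<phi> g > m \<and> \<psi> g < m)"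
proof -
  define U where "U g = {\<phi> \<in> topspace P. \<phi> g \<in> {m<..}} \<times> {\<psi> \<in> topspace P. \<psi> g \<in> {..<m}}" for g
  have ev: "continuous_map P euclideanreal (\<lambda>\<phi>. \<phi> g)" if "g \<in> D" for g
    unfolding P_def using that D by (intro continuous_map_product_projection) auto
  have "openin (prod_topology P P) (U g)" if "g \<in> D" for g
    unfolding U_def openin_prod_Times_iff
    using openin_continuous_map_preimage[OF ev[OF that], of "{m<..}"]
      openin_continuous_map_preimage[OF ev[OF that], of "{..<m}"] by simp
  moreover have "K1 \<times> K0 \<subseteq> \<Union>(U ` D)"
    using sep K compactin_subset_topspace[of P] by (fastforce simp: U_def)
  moreover have "compactin (prod_topology P P) (K1 \<times> K0)"
    using K by (simp add: compactin_Times)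
  ultimately obtain \<F> where "finite \<F>" "\<F> \<subseteq> U ` D" "K1 \<times> K0 \<subseteq> \<Union>\<F>"
    unfolding compactin_def by (metis (no_types, lifting) imageE)
  then obtain F where F: "finite F" "F \<subseteq> D" "K1 \<times> K0 \<subseteq> (\<Union>g\<in>F. U g)"
    by (metis finite_subset_image)
  have "\<exists>g\<in>F. \<phi> g > m \<and> \<psi> g < m" if "\<phi> \<in> K1" "\<psi> \<in> K0" for \<phi> \<psi>
    using F(3) that by (force simp: U_def)
  with F(1,2) show ?thesis by (intro exI[of _ F]) simp
qed

lemma Lip0_add:
  assumes "f \<in> Lip0 N e" "g \<in> Lip0 N e" "e \<in> mspace N"
  shows "(\<lambda>x\<in>mspace N. f x + g x) \<in> Lip0 N e"
proof -
  have "\<bar>(f x + g x) - (f y + g y)\<bar> \<le> (Lip_norm N f + Lip_norm N g) * mdist N x y"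
    if "x \<in> mspace N" "y \<in> mspace N" for x y
    using Lip_norm_bound[OF assms(1) that] Lip_norm_bound[OF assms(2) that]
    unfolding distrib_right by linarith
  then show ?thesis
    using assms unfolding Lip0_def Lipschitz_continuous_map_def
    by (auto simp: dist_real_def intro!: exI[of _ "Lip_norm N f + Lip_norm N g"])
qed

lemma Lip0_scale:
  assumes "f \<in> Lip0 N e" "e \<in> mspace N"
  shows "(\<lambda>x\<in>mspace N. c * f x) \<in> Lip0 N e"
proof -
  have "\<bar>c * f x - c * f y\<bar> \<le> (\<bar>c\<bar> * Lip_norm N f) * mdist N x y"
    if "x \<in> mspace N" "y \<in> mspace N" for x y
    using mult_left_mono[OF Lip_norm_bound[OF assms(1) that], of "\<bar>c\<bar>"]
    by (simp add: abs_mult[symmetric] right_diff_distrib mult.assoc)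
  then show ?thesis
    using assms unfolding Lip0_def Lipschitz_continuous_map_def
    by (auto simp: dist_real_def intro!: exI[of _ "\<bar>c\<bar> * Lip_norm N f"])
qed

text \<open>The unit ball of the dual space, realised inside the product over \<open>Lip0 N e\<close> (whence the
  extensionality) so that Tychonoff's theorem applies to it.\<close>

definition dual_ball :: "'b metric \<Rightarrow> 'b \<Rightarrow> (('b \<Rightarrow> real) \<Rightarrow> real) set" where
  "dual_ball N e =
     {\<phi> \<in> \<Pi>\<^sub>E f\<in>Lip0 N e. {- Lip_norm N f..Lip_norm N f}.
       (\<forall>f\<in>Lip0 N e. \<forall>g\<in>Lip0 N e. \<phi> (\<lambda>x\<in>mspace N. f x + g x) = \<phi> f + \<phi> g) \<and>
       (\<forall>f\<in>Lip0 N e. \<forall>c. \<phi> (\<lambda>x\<in>mspace N. c * f x) = c * \<phi> f)}"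

lemma dual_ball_subset_dual: "dual_ball N e \<subseteq> Lip0_dual N e"
proof
  fix \<phi> assume \<phi>: "\<phi> \<in> dual_ball N e"
  then have "\<bar>\<phi> f\<bar> \<le> 1 * Lip_norm N f" if "f \<in> Lip0 N e" for f
    using that by (force simp: dual_ball_def PiE_iff)
  with \<phi> show "\<phi> \<in> Lip0_dual N e"
    unfolding dual_ball_def Lip0_dual_def by blast
qed

text \<open>The Banach--Alaoglu theorem for \<open>Lip\<^sub>0(N)\<close>: the dual ball is cut out of a product of compact
  intervals by closed linear conditions.\<close>

lemma compactin_dual_ball:
  assumes e: "e \<in> mspace N"
  shows "compactin (product_topology (\<lambda>_. euclideanreal) (Lip0 N e)) (dual_ball N e)"
proof -
  let ?L = "Lip0 N e"
  let ?P = "product_topology (\<lambda>_. euclideanreal) ?L"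
  let ?box = "\<Pi>\<^sub>E f\<in>?L. {- Lip_norm N f..Lip_norm N f}"
  let ?add = "\<lambda>f g. {\<phi> \<in> topspace ?P. \<phi> (\<lambda>x\<in>mspace N. f x + g x) = \<phi> f + \<phi> g}"
  let ?scale = "\<lambda>f c. {\<phi> \<in> topspace ?P. \<phi> (\<lambda>x\<in>mspace N. c * f x) = c * \<phi> f}"
  have box: "compactin ?P ?box"
    by (simp add: compactin_PiE)
  have ev: "continuous_map ?P euclideanreal (\<lambda>\<phi>. \<phi> f)" if "f \<in> ?L" for f
    using that by (rule continuous_map_product_projection)
  have add: "closedin ?P (?add f g)" if "f \<in> ?L" "g \<in> ?L" for f g
    using that e
    by (intro closedin_continuous_maps_eq[of euclideanreal] ev continuous_map_add Lip0_add) auto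
  have scale: "closedin ?P (?scale f c)" if "f \<in> ?L" for f c
    using that e
    by (intro closedin_continuous_maps_eq[of euclideanreal] ev continuous_map_real_mult_left Lip0_scale) auto
  define \<F> where "\<F> = insert (topspace ?P)
    ((\<Union>f\<in>?L. \<Union>g\<in>?L. {?add f g}) \<union> (\<Union>f\<in>?L. \<Union>c. {?scale f c}))"
  have "closedin ?P (\<Inter>\<F>)"
  proof (rule closedin_Inter)
    fix S assume "S \<in> \<F>"
    then show "closedin ?P S"
      using add scale by (auto simp: \<F>_def simp del: topspace_product_topology)
  qed (simp add: \<F>_def)
  then have "compactin ?P (\<Inter>\<F> \<inter> ?box)"
    by (rule closed_Int_compactin[OF _ box])
  moreover have "\<Inter>\<F> \<inter> ?box = dual_ball N e"
    using compactin_subset_topspace[OF box]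
    by (auto simp: \<F>_def dual_ball_def ball_Un simp del: topspace_product_topology)
  ultimately show ?thesis by simp
qed

text \<open>For fixed \<open>A\<close>, two functionals in the dual ball taking the values \<open>1/2\<close> and \<open>0\<close> at the
  function \<open>f\<close> belonging to \<open>A\<close> define a weak neighbourhood of \<open>f\<close>, which meets \<open>D\<close>. Compactness
  of the dual ball makes finitely many points of \<open>D\<close> sufficient, which is what the counting lemma
  requires. It is essential that all functionals of the two sets, not only the
  difference quotients, are separated by points of \<open>D\<close>: the difference quotients alone need
  not form a compact set.\<close>

lemma card_of_Pow_le_weakly_dense:
  assumes e: "e \<in> mspace N" and inf: "infinite J"
    and D: "D \<subseteq> Lip0 N e"
    and dense: "\<And>W. openin (Lip0_weak_topology N e) W \<Longrightarrow> W \<noteq> {} \<Longrightarrow> D \<inter> W \<noteq> {}"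
    and pq: "\<And>i. i \<in> J \<Longrightarrow> p i \<in> mspace N \<and> q i \<in> mspace N \<and> p i \<noteq> q i"
    and ex: "\<And>A. A \<subseteq> J \<Longrightarrow> \<exists>f\<in>Lip0 N e. \<forall>i\<in>J.
       (f (p i) - f (q i)) / mdist N (p i) (q i) = (if i \<in> A then 1/2 else 0)"
  shows "|Pow J| \<le>o |D|"
proof -
  let ?L = "Lip0 N e"
  let ?P = "product_topology (\<lambda>_. euclideanreal) ?L"
  define \<delta> where "\<delta> i f = (f (p i) - f (q i)) / mdist N (p i) (q i)" for i f
  have \<delta>: "restrict (\<delta> i) ?L \<in> dual_ball N e" if i: "i \<in> J" for i
  proof -
    have pos: "mdist N (p i) (q i) > 0" using pq[OF i] by (simp add: Metric_space.mdist_pos_eq[OF Metric_space_mspace_mdist])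
    have "\<bar>\<delta> i f\<bar> \<le> Lip_norm N f" if "f \<in> ?L" for f
      using Lip_norm_bound[OF that, of "p i" "q i"] pq[OF i] pos
      by (simp add: \<delta>_def divide_le_eq)
    then have "\<delta> i f \<in> {- Lip_norm N f..Lip_norm N f}" if "f \<in> ?L" for f
      using that by (force simp: abs_le_iff)
    moreover have "\<delta> i (\<lambda>x\<in>mspace N. f x + g x) = \<delta> i f + \<delta> i g" for f g
      using pq[OF i] by (simp add: \<delta>_def add_divide_distrib[symmetric])
    moreover have "\<delta> i (\<lambda>x\<in>mspace N. c * f x) = c * \<delta> i f" for f c
      using pq[OF i] by (simp add: \<delta>_def right_diff_distrib)
    ultimately show ?thesis
      using e by (simp add: dual_ball_def Lip0_add Lip0_scale)
  qed
  have weak: "openin (Lip0_weak_topology N e) {g \<in> ?L. \<phi> g \<in> U}" if "\<phi> \<in> dual_ball N e" "open U" for \<phi> U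
    unfolding Lip0_weak_topology_def
    by (rule topology_generated_by_Basis, intro CollectI exI conjI)
      (use that in \<open>auto intro: subsetD[OF dual_ball_subset_dual]\<close>)
  show ?thesis
  proof (rule card_of_Pow_le_of_finite_separation[OF inf, where p = \<delta> and m = "1/4"])
    fix A assume A: "A \<subseteq> J"
    obtain f where f: "f \<in> ?L" "\<And>i. i \<in> J \<Longrightarrow> \<delta> i f = (if i \<in> A then 1/2 else 0)"
      using ex[OF A] unfolding \<delta>_def by blast
    define K where "K c = {\<phi> \<in> topspace ?P. \<phi> f \<in> {c}} \<inter> dual_ball N e" for c
    have K: "compactin ?P (K c)" for c
      unfolding K_def
    proof (rule closed_Int_compactin[OF _ compactin_dual_ball[OF e]])
      show "closedin ?P {\<phi> \<in> topspace ?P. \<phi> f \<in> {c}}"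
        using f(1) by (intro closedin_continuous_map_preimage[OF continuous_map_product_projection]) auto
    qed
    have "\<exists>g\<in>D. \<phi> g > 1/4 \<and> \<psi> g < 1/4" if "\<phi> \<in> K (1/2)" "\<psi> \<in> K 0" for \<phi> \<psi>
    proof -
      let ?W = "{g \<in> ?L. \<phi> g \<in> {1/4<..}} \<inter> {g \<in> ?L. \<psi> g \<in> {..<1/4}}"
      have "openin (Lip0_weak_topology N e) ?W"
        using that by (intro openin_Int weak) (auto simp: K_def)
      moreover have "f \<in> ?W" using f(1) that by (auto simp: K_def)
      ultimately show ?thesis using dense[of ?W] by auto
    qed
    then obtain F where F: "finite F" "F \<subseteq> D"
        "\<And>\<phi> \<psi>. \<phi> \<in> K (1/2) \<Longrightarrow> \<psi> \<in> K 0 \<Longrightarrow> \<exists>g\<in>F. \<phi> g > 1/4 \<and> \<psi> g < 1/4"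
      using finite_separation_of_compact[OF K K D, of "1/2" 0 "1/4"] by metis
    have mem: "restrict (\<delta> i) ?L \<in> K (if i \<in> A then 1/2 else 0)" if "i \<in> J" for i
      using \<delta>[OF that] f that by (simp add: K_def)
    have sep: "\<exists>g\<in>F. 1/4 < \<delta> i g \<and> \<delta> j g < 1/4" if "i \<in> A" "j \<in> J - A" for i j
    proof -
      have "i \<in> J" "j \<in> J" using that A by auto
      then have "restrict (\<delta> i) ?L \<in> K (1/2)" "restrict (\<delta> j) ?L \<in> K 0"
        using mem[of i] mem[of j] that by simp_all
      then have "\<exists>g\<in>F. restrict (\<delta> i) ?L g > 1/4 \<and> restrict (\<delta> j) ?L g < 1/4"
        by (rule F(3))
      with F(2) D show ?thesis by (metis restrict_apply' subsetD)
    qed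
    show "\<exists>F. finite F \<and> F \<subseteq> D \<and> (\<forall>i\<in>A. \<forall>j\<in>J - A. \<exists>g\<in>F. 1/4 < \<delta> i g \<and> \<delta> j g < 1/4)"
      by (intro exI[of _ F] conjI ballI F(1,2) sep)
  qed
qed


section \<open>Continuous surjections onto a space of Lipschitz functions\<close>

theorem theorem4p5:
  fixes X :: "'a topology" and N :: "'b metric" and e :: 'b
    and \<tau> :: "('a \<Rightarrow> real) topology" and \<tau>' :: "('b \<Rightarrow> real) topology"
  assumes "tychonoff_space X" and "infinite (topspace X)"
    and "infinite (mspace N)" and "e \<in> mspace N"
    and "topology_weight X <o ctwo ^c topology_density (mtopology_of N)"
    and "coarser_topology (pointwise_topology X) \<tau>"
    and "coarser_topology \<tau> (compact_open_topology X)"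
    and "coarser_topology (Lip0_weak_topology N e) \<tau>'"
  shows "\<not> (\<exists>T. continuous_map \<tau> \<tau>' T \<and> T ` topspace \<tau> = topspace \<tau>')"
proof
  assume "\<exists>T. continuous_map \<tau> \<tau>' T \<and> T ` topspace \<tau> = topspace \<tau>'"
  then obtain T where T: "continuous_map \<tau> \<tau>' T" "T ` topspace \<tau> = topspace \<tau>'" by blast
  have top: "topspace \<tau> = cont_fun X" "topspace \<tau>' = Lip0 N e"
    using assms(7,8) by (simp_all add: coarser_topology_def)
  obtain E where E: "E \<subseteq> cont_fun X" "|E| \<le>o topology_weight X"
    "\<And>W. openin (compact_open_topology X) W \<Longrightarrow> W \<noteq> {} \<Longrightarrow> E \<inter> W \<noteq> {}"
    using compact_open_dense_subset assms(1,2) unfolding tychonoff_space_def by blast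
  obtain \<J> :: "'b set set" and p q where J: "infinite \<J>" "topology_density (mtopology_of N) \<le>o |\<J>|"
    "\<And>C. C \<in> \<J> \<Longrightarrow> p C \<in> mspace N \<and> q C \<in> mspace N \<and> p C \<noteq> q C"
    "\<And>\<A>. \<A> \<subseteq> \<J> \<Longrightarrow> \<exists>f\<in>Lip0 N e. \<forall>C\<in>\<J>.
       (f (p C) - f (q C)) / mdist N (p C) (q C) = (if C \<in> \<A> then 1/2 else 0)"
    using Lip0_separating_pairs[OF assms(3,4)] by metis
  have "|Pow \<J>| \<le>o |T ` E|"
  proof (rule card_of_Pow_le_weakly_dense[OF assms(4) J(1) _ _ J(3,4)])
    show "T ` E \<subseteq> Lip0 N e" using T(2) E(1) top by blast
    fix W assume W: "openin (Lip0_weak_topology N e) W" "W \<noteq> {}"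
    then have "openin \<tau>' W" using assms(8) by (simp add: coarser_topology_def)
    then have "openin \<tau> {f \<in> topspace \<tau>. T f \<in> W}"
      by (rule openin_continuous_map_preimage[OF T(1)])
    then have "openin (compact_open_topology X) {f \<in> topspace \<tau>. T f \<in> W}"
      using assms(7) by (simp add: coarser_topology_def)
    moreover have "{f \<in> topspace \<tau>. T f \<in> W} \<noteq> {}"
    proof -
      obtain g where "g \<in> W" using W(2) by auto
      moreover from this have "g \<in> T ` topspace \<tau>"
        using openin_subset[OF \<open>openin \<tau>' W\<close>] unfolding T(2) by (rule subsetD[rotated])
      ultimately show ?thesis by auto
    qed
    ultimately have "E \<inter> {f \<in> topspace \<tau>. T f \<in> W} \<noteq> {}" by (rule E(3))
    then show "T ` E \<inter> W \<noteq> {}" by auto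
  qed
  then have "|Pow \<J>| \<le>o topology_weight X"
    by (rule ordLeq_transitive[OF _ ordLeq_transitive[OF card_of_image E(2)]])
  then have lt: "|Pow \<J>| <o ctwo ^c topology_density (mtopology_of N)"
    using assms(5) by (rule ordLeq_ordLess_trans)
  obtain D where D: "topology_density (mtopology_of N) = |D|"
    using topology_density by blast
  have "ctwo ^c topology_density (mtopology_of N) =o |Pow D|"
    unfolding D cexp_def ctwo_def Field_card_of by (rule ordIso_symmetric[OF card_of_Pow_Func])
  moreover have "|Pow D| \<le>o |Pow \<J>|"
    using J(2) unfolding D card_of_ordLeq[symmetric] by (metis inj_on_image_Pow image_Pow_mono)
  ultimately have "ctwo ^c topology_density (mtopology_of N) \<le>o |Pow \<J>|"
    by (rule ordIso_ordLeq_trans)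
  with lt show False using not_ordLess_ordLeq by blast
qed

end
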